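(* For first-passage percolation with stationary-ergodic edge-weights $\tau$ satisfying $0<a\le\tau\le b<\infty$, the limiting Hamiltonian $\overline{H}$ is the dual norm of the time-constant $m$ on $\mathbb{R}^d$, i.e. for every $p\in\mathbb{R}^d$ $$\overline{H}(p)=\sup_{x\in\mathbb{R}^d:\ m(x)=1}p\cdot x .$$
   Context: Let $d\ge 1$, $A=\{\pm e_1,\dots,\pm e_d\}$ with $e_i$ the canonical basis of $\mathbb{Z}^d$, and $(\Omega,\mathcal{F},\mathbb{P})$ a probability space with invertible measure-preserving maps $\{V_z\}_{z\in\mathbb{Z}^d}$, $V_{z+w}=V_z\circ V_w$, that are ergodic (every event $B$ with $V_zB=B$ for every $z$ has probability $0$ or $1$). The edge-weights $\tau:\mathbb{Z}^d\times A\times\Omega\to\mathbb{R}$ ($\tau(x,\alpha,\omega)$ is the weight of the directed edge from $x$ to $x+\alpha$) are stationary: $\tau(x+z,\alpha,\omega)=\tau(x,\alpha,V_z\omega)$ for all $x,z\in\mathbb{Z}^d$, and $0<a=\operatorname{ess\,inf}_{x,\alpha,\omega}\tau$, $b=\operatorname{ess\,sup}_{x,\alpha,\omega}\tau<\infty$. First-passage time: for a nearest-neighbour path $\gamma=(v_1,\dots,v_n)$ from $v_1=x$ to $v_n=y$ put $\mathcal{W}(\gamma)=\sum_{i=1}^{n-1}\tau(v_i,v_{i+1}-v_i,\omega)$; $\mathcal{T}(x,y)=\inf_\gamma\mathcal{W}(\gamma)$ over all such paths, and $\mathcal{T}(x)=\mathcal{T}(x,0)$. The time-constant is $m(x)=\lim_{n\to\infty}\mathcal{T}([nx])/n$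 for $x\in\mathbb{R}^d$ (the a.s. deterministic limit, which exists), where $[y]$ is the closest lattice point to $y$ (ties broken uniformly). Limiting Hamiltonian: for $p\in\mathbb{R}^d$, $x\in\mathbb{Z}^d$, $t\ge 0$ let $\mu_p(x,t)$ be the infimum, over all integers $k\ge0$ and all nearest-neighbour paths $x=v_0,v_1,\dots,v_k$ with $\sum_{i=0}^{k-1}\tau(v_i,v_{i+1}-v_i,\omega)\le t$, of $\sum_{i=0}^{k-1}p\cdot(v_{i+1}-v_i)$. Then $\overline{H}(p)=-\lim_{t\to\infty}\mu_p(0,t)/t$ (the a.s. deterministic limit, which exists). "Norm" is used in the sense of a positively $1$-homogeneous, convex function vanishing only at $0$. *)

theory Defs
  imports "HOL-Probability.Probability"
begin

section \<open>Stationary ergodic edge weights on the lattice\<close>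

text \<open>
  The lattice is \<^typ>\<open>int ^ 'd\<close> and the ambient space is \<^typ>\<open>real ^ 'd\<close>, for a finite index
  type of arbitrary (positive) cardinality.
\<close>

definition lattice_embed :: "int ^ 'd \<Rightarrow> real ^ 'd" where
  "lattice_embed z = (\<chi> i. real_of_int (z $ i))"

definition unit_steps :: "(int ^ 'd) set" where
  "unit_steps = range (\<lambda>i. axis i 1) \<union> range (\<lambda>i. - axis i 1)"

type_synonym ('d, 'w) weights = "int ^ 'd \<Rightarrow> int ^ 'd \<Rightarrow> 'w \<Rightarrow> real"

text \<open>
  The weight of the directed edge from \<open>x\<close> to \<open>x + \<alpha>\<close> is \<open>\<tau> x \<alpha> \<omega>\<close>; values at \<open>\<alpha>\<close> outside
  \<^const>\<open>unit_steps\<close> are never used. The essential bounds are taken jointly over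
  \<open>(x, \<alpha>, \<omega>)\<close>: since the set of edges is countable, this is the extremum over the edges of the
  essential bounds in \<open>\<omega>\<close>. The values are extended reals, and the essential infimum
  of \<open>f\<close> is minus the essential supremum of \<open>- f\<close>.
\<close>

definition weight_esssup :: "'w measure \<Rightarrow> ('d::finite, 'w) weights \<Rightarrow> ereal" where
  "weight_esssup M \<tau> = (SUP x. SUP \<alpha>\<in>unit_steps. esssup M (\<lambda>\<omega>. ereal (\<tau> x \<alpha> \<omega>)))"

definition weight_essinf :: "'w measure \<Rightarrow> ('d::finite, 'w) weights \<Rightarrow> ereal" where
  "weight_essinf M \<tau> = (INF x. INF \<alpha>\<in>unit_steps. - esssup M (\<lambda>\<omega>. - ereal (\<tau> x \<alpha> \<omega>)))"

locale stationary_ergodic_fpp = prob_space M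
  for M :: "'w measure" +
  fixes V :: "int ^ 'd::finite \<Rightarrow> 'w \<Rightarrow> 'w"
    and \<tau> :: "('d, 'w) weights"
  assumes V_measurable: "V z \<in> measurable M M"
    and V_invertible: "bij_betw (V z) (space M) (space M)"
    and V_measure_preserving: "distr M M (V z) = M"
    and V_add: "\<omega> \<in> space M \<Longrightarrow> V (z + w) \<omega> = V z (V w \<omega>)"
    and V_ergodic: "B \<in> events \<Longrightarrow> (\<And>z. V z ` B = B) \<Longrightarrow> prob B = 0 \<or> prob B = 1"
    and weight_measurable: "\<alpha> \<in> unit_steps \<Longrightarrow> \<tau> x \<alpha> \<in> borel_measurable M"
    and weight_stationary:
      "\<alpha> \<in> unit_steps \<Longrightarrow> \<omega> \<in> space M \<Longrightarrow> \<tau> (x + z) \<alpha> \<omega> = \<tau> x \<alpha> (V z \<omega>)"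
    and weight_lower: "0 < weight_essinf M \<tau>"
    and weight_upper: "weight_esssup M \<tau> < \<infinity>"

section \<open>First-passage times and the time constant\<close>

definition nn_path :: "(int ^ 'd) list \<Rightarrow> bool" where
  "nn_path vs \<longleftrightarrow> vs \<noteq> [] \<and> successively (\<lambda>v w. w - v \<in> unit_steps) vs"

definition path_weight :: "('d::finite, 'w) weights \<Rightarrow> 'w \<Rightarrow> (int ^ 'd) list \<Rightarrow> real" where
  "path_weight \<tau> \<omega> vs = (\<Sum>i<length vs - 1. \<tau> (vs ! i) (vs ! Suc i - vs ! i) \<omega>)"

text \<open>
  The two infima below are taken in the reals. Both index sets are nonempty (the second one
  for \<open>t \<ge> 0\<close>), and almost surely both families are bounded below because the weights are.
\<close>

definition passage_time ::
  "('d::finite, 'w) weights \<Rightarrow> 'w \<Rightarrow> int ^ 'd \<Rightarrow> int ^ 'd \<Rightarrow> real" where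
  "passage_time \<tau> \<omega> x y =
     (INF vs\<in>{vs. nn_path vs \<and> hd vs = x \<and> last vs = y}. path_weight \<tau> \<omega> vs)"

text \<open>
  A choice of the closest lattice point to each \<open>y\<close>. The way ties are broken is arbitrary and
  may depend on \<open>\<omega>\<close>, so that both fixed and random rules are covered.
\<close>

definition nearest_lattice_point ::
  "'w measure \<Rightarrow> (real ^ 'd \<Rightarrow> 'w \<Rightarrow> int ^ 'd::finite) \<Rightarrow> bool" where
  "nearest_lattice_point M nr \<longleftrightarrow>
     (\<forall>\<omega>\<in>space M. \<forall>y z. dist y (lattice_embed (nr y \<omega>)) \<le> dist y (lattice_embed z))"

definition is_time_constant ::
  "'w measure \<Rightarrow> ('d::finite, 'w) weights \<Rightarrow> (real ^ 'd \<Rightarrow> 'w \<Rightarrow> int ^ 'd)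
     \<Rightarrow> (real ^ 'd \<Rightarrow> real) \<Rightarrow> bool" where
  "is_time_constant M \<tau> nr m \<longleftrightarrow>
     (\<forall>x. AE \<omega> in M.
        (\<lambda>n::nat. passage_time \<tau> \<omega> (nr (real n *\<^sub>R x) \<omega>) 0 / real n) \<longlonglongrightarrow> m x)"

section \<open>The limiting Hamiltonian\<close>

definition control_value ::
  "('d::finite, 'w) weights \<Rightarrow> real ^ 'd \<Rightarrow> int ^ 'd \<Rightarrow> real \<Rightarrow> 'w \<Rightarrow> real" where
  "control_value \<tau> p x t \<omega> =
     (INF vs\<in>{vs. nn_path vs \<and> hd vs = x \<and> path_weight \<tau> \<omega> vs \<le> t}.
        \<Sum>i<length vs - 1. p \<bullet> lattice_embed (vs ! Suc i - vs ! i))"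

definition is_limiting_hamiltonian ::
  "'w measure \<Rightarrow> ('d::finite, 'w) weights \<Rightarrow> (real ^ 'd \<Rightarrow> real) \<Rightarrow> bool" where
  "is_limiting_hamiltonian M \<tau> H \<longleftrightarrow>
     (\<forall>p. AE \<omega> in M. ((\<lambda>t::real. - (control_value \<tau> p 0 t \<omega> / t)) \<longlongrightarrow> H p) at_top)"

section \<open>Norms\<close>

text \<open>Norms in the wide sense: no symmetry \<open>N (- x) = N x\<close> is required.\<close>

definition is_norm :: "('a::real_vector \<Rightarrow> real) \<Rightarrow> bool" where
  "is_norm N \<longleftrightarrow>
     (\<forall>c x. 0 < c \<longrightarrow> N (c *\<^sub>R x) = c * N x) \<and> convex_on UNIV N \<and> (\<forall>x. N x = 0 \<longleftrightarrow> x = 0)"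

end

theory Submission
  imports Defs
begin

text \<open>
  Let \<open>T(x, y)\<close> be the passage time. A path from \<open>0\<close> to \<open>v\<close> contributes the telescoping sum \<open>p \<bullet> v\<close>
  to the control problem, so \<open>- control_value \<tau> p 0 t \<omega>\<close> is essentially the largest value of
  \<open>p \<bullet> (- v)\<close> over all \<open>v\<close> with \<open>T(0, v) \<le> t\<close>. By stationarity \<open>T(0, v)\<close> is distributed as
  \<open>T(- v, 0)\<close>, which is about \<open>m (- v)\<close>. After rescaling by \<open>t\<close>, \<open>H p\<close> is therefore the largest
  value of \<open>p \<bullet> x\<close> over all \<open>x\<close> with \<open>m x \<le> 1\<close>, which is the dual norm.

  The existence of the limits \<open>m\<close> and \<open>H\<close> is given, so what is left is to identify them, and for
  this it suffices to find one environment \<open>\<omega>\<close> in which all relevant quantities are near their limits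
  for infinitely many \<open>n\<close>. Its existence follows from an elementary argument
  (\<open>frequently_shifted\<close>): events that occur almost surely for all large \<open>n\<close> have probabilities
  that tend to 1; shifting them by \<open>V z\<close>, with \<open>z\<close> depending on \<open>n\<close>, does not change the probabilities; and
  events with probabilities tending to 1 occur together, for infinitely many \<open>n\<close>, at some \<open>\<omega>\<close> in any
  given event of full probability.

  The bounds \<open>0 < a \<le> \<tau> \<le> b\<close> make \<open>T(x, y)\<close> comparable to the Euclidean distance. Hence the
  rounding to lattice points is harmless, \<open>m\<close> vanishes only at 0, and the points that are reachable
  in time \<open>t\<close> lie in a ball of radius \<open>t / a\<close>, so that finitely many directions suffice for the upper bound
  on \<open>H\<close> (\<open>hamiltonian_le\<close>). Subadditivity of \<open>m\<close> comes from the triangle inequality for \<open>T\<close> and again a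
  shift (\<open>time_constant_add\<close>). Finally, \<open>H p\<close> is the least constant \<open>S\<close> with \<open>p \<bullet> x \<le> S * m x\<close> for all
  \<open>x\<close> (\<open>inner_le_hamiltonian\<close> and \<open>hamiltonian_le\<close>), which gives the formula and the norm
  properties of \<open>H\<close>.
\<close>

section \<open>Lattice points and real points\<close>

lemma lattice_embed_simps [simp]:
  "lattice_embed 0 = 0"
  "lattice_embed (x + y) = lattice_embed x + lattice_embed y"
  "lattice_embed (x - y) = lattice_embed x - lattice_embed y"
  "lattice_embed (- x) = - lattice_embed x"
  by (simp_all add: lattice_embed_def vec_eq_iff)

lemma norm_lattice_embed_step:
  fixes \<alpha> :: "int ^ 'd::finite"
  assumes "\<alpha> \<in> unit_steps"
  shows "norm (lattice_embed \<alpha>) = 1"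
proof -
  have "lattice_embed (axis i 1) = (axis i 1 :: real ^ 'd)" for i :: 'd
    by (simp add: lattice_embed_def vec_eq_iff axis_def)
  then show ?thesis
    using assms by (auto simp: unit_steps_def)
qed

definition lattice_floor :: "real ^ 'd \<Rightarrow> int ^ 'd::finite" where
  "lattice_floor x = (\<chi> i. \<lfloor>x $ i\<rfloor>)"

lemma norm_le_card:
  fixes x :: "real ^ 'd::finite"
  assumes "\<And>i. \<bar>x $ i\<bar> \<le> 1"
  shows "norm x \<le> real CARD('d)"
proof -
  have "norm x \<le> (\<Sum>i\<in>UNIV. \<bar>x $ i\<bar>)" by (rule norm_le_l1_cart)
  also have "\<dots> \<le> (\<Sum>i\<in>(UNIV::'d set). 1)" by (rule sum_mono) (use assms in auto)
  finally show ?thesis by simp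
qed

lemma norm_lattice_floor:
  fixes x :: "real ^ 'd::finite"
  shows "norm (lattice_embed (lattice_floor x) - x) \<le> real CARD('d)"
proof (rule norm_le_card)
  fix i
  show "\<bar>(lattice_embed (lattice_floor x) - x) $ i\<bar> \<le> 1"
    unfolding lattice_embed_def lattice_floor_def
    by simp linarith
qed

section \<open>Paths in an environment with bounded weights\<close>

lemma sum_steps_Cons:
  fixes f :: "'a \<Rightarrow> 'a \<Rightarrow> real"
  shows "(\<Sum>i<length (v # w # vs) - 1. f ((v # w # vs) ! i) ((v # w # vs) ! Suc i)) =
    f v w + (\<Sum>i<length (w # vs) - 1. f ((w # vs) ! i) ((w # vs) ! Suc i))"
  by (simp add: sum.lessThan_Suc_shift del: sum.lessThan_Suc)

lemma path_weight_Cons: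
  "path_weight \<tau> \<omega> (v # w # vs) = \<tau> v (w - v) \<omega> + path_weight \<tau> \<omega> (w # vs)"
  unfolding path_weight_def by (rule sum_steps_Cons)

lemma path_weight_single [simp]: "path_weight \<tau> \<omega> [v] = 0"
  by (simp add: path_weight_def)

lemma nn_path_single [simp]: "nn_path [v]"
  by (simp add: nn_path_def)

lemma nn_path_Cons: "nn_path (v # w # vs) \<longleftrightarrow> w - v \<in> unit_steps \<and> nn_path (w # vs)"
  by (simp add: nn_path_def)

lemma nn_path_induct [consumes 1, case_names single Cons]:
  assumes "nn_path vs"
    and "\<And>v. Q [v]"
    and "\<And>v w vs. w - v \<in> unit_steps \<Longrightarrow> nn_path (w # vs) \<Longrightarrow> Q (w # vs) \<Longrightarrow> Q (v # w # vs)"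
  shows "Q vs"
  using assms(1)
proof (induction vs rule: induct_list012)
  case 1
  then show ?case by (simp add: nn_path_def)
qed (use assms(2,3) in \<open>auto simp: nn_path_Cons\<close>)

lemma nn_path_append:
  assumes "nn_path us" "nn_path vs" "last us = hd vs"
  shows "nn_path (us @ tl vs) \<and> hd (us @ tl vs) = hd us \<and> last (us @ tl vs) = last vs \<and>
    path_weight \<tau> \<omega> (us @ tl vs) = path_weight \<tau> \<omega> us + path_weight \<tau> \<omega> vs"
  using assms
proof (induction us rule: nn_path_induct)
  case (single v)
  then have "[v] @ tl vs = vs"
    by (cases vs) (auto simp: nn_path_def)
  with single show ?case by simp
qed (auto simp: nn_path_Cons path_weight_Cons)

lemma nn_path_translate:
  assumes "nn_path vs"
  shows "nn_path (map (\<lambda>v. v + z) vs) \<and> hd (map (\<lambda>v. v + z) vs) = hd vs + z \<and>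
    last (map (\<lambda>v. v + z) vs) = last vs + z"
  using assms by (induction vs rule: nn_path_induct) (auto simp: nn_path_Cons)

lemma sum_steps_telescope:
  assumes "nn_path vs"
  shows "(\<Sum>i<length vs - 1. p \<bullet> lattice_embed (vs ! Suc i - vs ! i)) =
    p \<bullet> lattice_embed (last vs - hd vs)"
  using assms
proof (induction vs rule: nn_path_induct)
  case (Cons v w vs)
  show ?case
    unfolding sum_steps_Cons[where f = "\<lambda>x y. p \<bullet> lattice_embed (y - x)"] Cons.IH
    by (simp add: inner_diff_right)
qed simp

definition weights_between ::
  "('d::finite, 'w) weights \<Rightarrow> real \<Rightarrow> real \<Rightarrow> 'w \<Rightarrow> bool" where
  "weights_between \<tau> a b \<omega> \<longleftrightarrow> (\<forall>x. \<forall>\<alpha>\<in>unit_steps. a \<le> \<tau> x \<alpha> \<omega> \<and> \<tau> x \<alpha> \<omega> \<le> b)"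

lemma path_weight_ge:
  assumes "nn_path vs" "weights_between \<tau> a b \<omega>" "0 \<le> a"
  shows "a * norm (lattice_embed (last vs) - lattice_embed (hd vs)) \<le> path_weight \<tau> \<omega> vs"
  using assms(1)
proof (induction vs rule: nn_path_induct)
  case (Cons v w vs)
  have "norm (lattice_embed (last (w # vs)) - lattice_embed v) \<le>
      norm (lattice_embed (last (w # vs)) - lattice_embed w) + norm (lattice_embed (w - v))"
    using norm_triangle_ineq[of "lattice_embed (last (w # vs)) - lattice_embed w" "lattice_embed (w - v)"]
    by (simp del: last.simps)
  also have "norm (lattice_embed (w - v)) = 1"
    using Cons.hyps by (simp only: norm_lattice_embed_step)
  finally have "a * norm (lattice_embed (last (w # vs)) - lattice_embed v) \<le>
      a * norm (lattice_embed (last (w # vs)) - lattice_embed w) + a"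
    using mult_left_mono[OF _ \<open>0 \<le> a\<close>, of _ "norm (lattice_embed (last (w # vs)) - lattice_embed w) + 1"]
    by (simp add: distrib_left del: last.simps)
  moreover have "a \<le> \<tau> v (w - v) \<omega>"
    using Cons.hyps assms(2) by (simp add: weights_between_def)
  ultimately show ?case
    using Cons.IH by (simp add: path_weight_Cons)
qed simp

text \<open>
  As long as \<open>x\<close> and \<open>y\<close> differ in some coordinate, a step towards \<open>y\<close> along it reduces the sum of the
  coordinate distances by 1.
\<close>

lemma exists_short_path:
  fixes x y :: "int ^ 'd::finite"
  assumes "weights_between \<tau> a b \<omega>" "0 \<le> b"
  shows "\<exists>vs. nn_path vs \<and> hd vs = x \<and> last vs = y \<and>
    path_weight \<tau> \<omega> vs \<le> b * (\<Sum>i\<in>UNIV. real_of_int \<bar>(y - x) $ i\<bar>)"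
proof (induction "\<Sum>i\<in>UNIV. nat \<bar>(y - x) $ i\<bar>" arbitrary: x)
  case 0
  then have "y = x" by (simp add: vec_eq_iff)
  then show ?case by (intro exI[of _ "[x]"]) simp
next
  case (Suc n)
  let ?l = "\<lambda>x. \<Sum>i\<in>UNIV. nat \<bar>(y - x) $ i\<bar>"
  have l_real: "(\<Sum>i\<in>UNIV. real_of_int \<bar>(y - x) $ i\<bar>) = real (?l x)" for x
    by (simp add: of_nat_sum)
  obtain i where i: "(y - x) $ i \<noteq> 0"
    using Suc.hyps(2) by (metis (no_types, lifting) abs_zero nat_0 nat.simps(3) sum.neutral)
  define s :: "int ^ 'd" where "s = (if (y - x) $ i > 0 then axis i 1 else - axis i 1)"
  have s: "s \<in> unit_steps" by (auto simp: s_def unit_steps_def)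
  have "?l x = nat \<bar>(y - x) $ i\<bar> + (\<Sum>j\<in>UNIV - {i}. nat \<bar>(y - x) $ j\<bar>)"
    by (rule sum.remove) auto
  moreover have "?l (x + s) = nat \<bar>(y - (x + s)) $ i\<bar> + (\<Sum>j\<in>UNIV - {i}. nat \<bar>(y - (x + s)) $ j\<bar>)"
    by (rule sum.remove) auto
  moreover have "(\<Sum>j\<in>UNIV - {i}. nat \<bar>(y - (x + s)) $ j\<bar>) = (\<Sum>j\<in>UNIV - {i}. nat \<bar>(y - x) $ j\<bar>)"
    by (rule sum.cong) (auto simp: s_def axis_def)
  moreover have "nat \<bar>(y - x) $ i\<bar> = Suc (nat \<bar>(y - (x + s)) $ i\<bar>)"
    using i by (auto simp: s_def axis_def)
  ultimately have l: "?l x = Suc (?l (x + s))" by simp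
  then have "n = ?l (x + s)" using Suc.hyps(2) by simp
  from Suc.hyps(1)[OF this] obtain vs where vs: "nn_path vs" "hd vs = x + s" "last vs = y"
    "path_weight \<tau> \<omega> vs \<le> b * real (?l (x + s))"
    unfolding l_real by blast
  then obtain ws where ws: "vs = (x + s) # ws"
    by (cases vs) (auto simp: nn_path_def)
  have "\<tau> x s \<omega> \<le> b" using assms s by (simp add: weights_between_def)
  then have "path_weight \<tau> \<omega> (x # vs) \<le> b * real (?l x)"
    using vs(4) unfolding l by (simp add: ws path_weight_Cons algebra_simps)
  then show ?case
    unfolding l_real using vs s by (intro exI[of _ "x # vs"]) (simp add: ws nn_path_Cons)
qed

lemma passage_time_bdd_below:
  assumes "weights_between \<tau> a b \<omega>" "0 \<le> a"
  shows "bdd_below (path_weight \<tau> \<omega> ` {vs. nn_path vs \<and> hd vs = x \<and> last vs = y})"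
proof (rule bdd_belowI2)
  fix vs assume "vs \<in> {vs. nn_path vs \<and> hd vs = x \<and> last vs = y}"
  then show "0 \<le> path_weight \<tau> \<omega> vs"
    using path_weight_ge[of vs \<tau> a b \<omega>] assms
    by (smt (verit) mem_Collect_eq mult_nonneg_nonneg norm_ge_zero)
qed

lemma passage_time_le:
  assumes "weights_between \<tau> a b \<omega>" "0 \<le> a" "nn_path vs"
  shows "passage_time \<tau> \<omega> (hd vs) (last vs) \<le> path_weight \<tau> \<omega> vs"
  unfolding passage_time_def
  by (rule cINF_lower[OF passage_time_bdd_below[OF assms(1,2)]]) (use assms in auto)

lemma paths_nonempty: "{vs. nn_path vs \<and> hd vs = x \<and> last vs = y} \<noteq> {}"
proof -
  \<comment> \<open>The existence of a path does not involve the weights, so trivial ones can be chosen.\<close>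
  have "weights_between (\<lambda>_ _ _. 0) 0 0 ()"
    by (simp add: weights_between_def)
  from exists_short_path[OF this] show ?thesis by blast
qed

lemma passage_time_less_path:
  assumes "passage_time \<tau> \<omega> x y < c"
  obtains vs where "nn_path vs" "hd vs = x" "last vs = y" "path_weight \<tau> \<omega> vs < c"
proof -
  have "\<exists>r\<in>path_weight \<tau> \<omega> ` {vs. nn_path vs \<and> hd vs = x \<and> last vs = y}. r < c"
    using assms paths_nonempty[of x y] unfolding passage_time_def
    by (intro cInf_lessD) auto
  then show thesis using that by blast
qed

lemma passage_time_ge:
  assumes "weights_between \<tau> a b \<omega>" "0 \<le> a"
  shows "a * norm (lattice_embed x - lattice_embed y) \<le> passage_time \<tau> \<omega> x y"
  unfolding passage_time_def
proof (rule cINF_greatest[OF paths_nonempty])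
  fix vs assume "vs \<in> {vs. nn_path vs \<and> hd vs = x \<and> last vs = y}"
  then show "a * norm (lattice_embed x - lattice_embed y) \<le> path_weight \<tau> \<omega> vs"
    using path_weight_ge[OF _ assms, of vs] by (auto simp: norm_minus_commute)
qed

lemma passage_time_upper:
  fixes x y :: "int ^ 'd::finite"
  assumes "weights_between \<tau> a b \<omega>" "0 \<le> a" "0 \<le> b"
  shows "passage_time \<tau> \<omega> x y \<le>
    b * real CARD('d) * norm (lattice_embed x - lattice_embed y)"
proof -
  obtain vs where vs: "nn_path vs" "hd vs = x" "last vs = y"
    "path_weight \<tau> \<omega> vs \<le> b * (\<Sum>i\<in>UNIV. real_of_int \<bar>(y - x) $ i\<bar>)"
    using exists_short_path[OF assms(1,3)] by blast
  have "real_of_int \<bar>(y - x) $ i\<bar> \<le> norm (lattice_embed x - lattice_embed y)" for i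
    using component_le_norm_cart[of "lattice_embed y - lattice_embed x" i]
    by (subst norm_minus_commute) (simp add: lattice_embed_def)
  then have "(\<Sum>i\<in>UNIV. real_of_int \<bar>(y - x) $ i\<bar>) \<le>
      (\<Sum>i\<in>(UNIV::'d set). norm (lattice_embed x - lattice_embed y))"
    by (rule sum_mono)
  then have "b * (\<Sum>i\<in>UNIV. real_of_int \<bar>(y - x) $ i\<bar>) \<le>
      b * (real CARD('d) * norm (lattice_embed x - lattice_embed y))"
    by (intro mult_left_mono) (use assms in auto)
  with passage_time_le[OF assms(1,2) vs(1)] vs show ?thesis by (simp add: mult.assoc)
qed

lemma passage_time_triangle:
  assumes "weights_between \<tau> a b \<omega>" "0 \<le> a"
  shows "passage_time \<tau> \<omega> x z \<le> passage_time \<tau> \<omega> x y + passage_time \<tau> \<omega> y z"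
proof (rule field_le_epsilon)
  fix e :: real assume e: "0 < e"
  obtain us where us: "nn_path us" "hd us = x" "last us = y"
    "path_weight \<tau> \<omega> us < passage_time \<tau> \<omega> x y + e / 2"
    using passage_time_less_path[of \<tau> \<omega> x y "passage_time \<tau> \<omega> x y + e / 2"] e by auto
  obtain vs where vs: "nn_path vs" "hd vs = y" "last vs = z"
    "path_weight \<tau> \<omega> vs < passage_time \<tau> \<omega> y z + e / 2"
    using passage_time_less_path[of \<tau> \<omega> y z "passage_time \<tau> \<omega> y z + e / 2"] e by auto
  have j: "nn_path (us @ tl vs)" "hd (us @ tl vs) = x" "last (us @ tl vs) = z"
    "path_weight \<tau> \<omega> (us @ tl vs) = path_weight \<tau> \<omega> us + path_weight \<tau> \<omega> vs"
    using nn_path_append[of us vs \<tau> \<omega>] us vs by auto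
  show "passage_time \<tau> \<omega> x z \<le> passage_time \<tau> \<omega> x y + passage_time \<tau> \<omega> y z + e"
    using passage_time_le[OF assms j(1)] j us(4) vs(4) by simp
qed

lemma control_value_le:
  assumes "weights_between \<tau> a b \<omega>" "0 < a" "passage_time \<tau> \<omega> 0 v < t"
  shows "control_value \<tau> p 0 t \<omega> \<le> p \<bullet> lattice_embed v"
proof -
  let ?S = "{vs. nn_path vs \<and> hd vs = 0 \<and> path_weight \<tau> \<omega> vs \<le> t}"
  let ?f = "\<lambda>vs. \<Sum>i<length vs - 1. p \<bullet> lattice_embed (vs ! Suc i - vs ! i)"
  have bdd: "bdd_below (?f ` ?S)"
  \<comment> \<open>Each step takes at least time \<open>a\<close>, so the endpoint is within distance \<open>t / a\<close>.\<close>
  proof (rule bdd_belowI2)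
    fix vs assume vs: "vs \<in> ?S"
    then have "a * norm (lattice_embed (last vs)) \<le> t"
      using path_weight_ge[of vs \<tau> a b \<omega>] assms by auto
    then have "norm (lattice_embed (last vs)) \<le> t / a"
      using assms(2) by (simp add: pos_le_divide_eq mult.commute)
    then have "norm p * norm (lattice_embed (last vs)) \<le> norm p * (t / a)"
      by (rule mult_left_mono) simp
    moreover have "\<bar>p \<bullet> lattice_embed (last vs)\<bar> \<le> norm p * norm (lattice_embed (last vs))"
      by (rule Cauchy_Schwarz_ineq2)
    moreover have "?f vs = p \<bullet> lattice_embed (last vs)"
      using sum_steps_telescope[of vs p] vs by simp
    ultimately show "- (norm p * (t / a)) \<le> ?f vs" by linarith
  qed
  obtain vs where vs: "nn_path vs" "hd vs = 0" "last vs = v" "path_weight \<tau> \<omega> vs < t"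
    using passage_time_less_path[OF assms(3)] .
  then have "vs \<in> ?S" by simp
  then have "control_value \<tau> p 0 t \<omega> \<le> ?f vs"
    unfolding control_value_def by (rule cINF_lower[OF bdd])
  then show ?thesis using sum_steps_telescope[OF vs(1), of p] vs by simp
qed

lemma control_value_less_endpoint:
  assumes "weights_between \<tau> a b \<omega>" "0 \<le> a" "0 \<le> t" "control_value \<tau> p 0 t \<omega> < c"
  obtains v where "passage_time \<tau> \<omega> 0 v \<le> t" "p \<bullet> lattice_embed v < c"
proof -
  let ?S = "{vs. nn_path vs \<and> hd vs = 0 \<and> path_weight \<tau> \<omega> vs \<le> t}"
  let ?f = "\<lambda>vs. \<Sum>i<length vs - 1. p \<bullet> lattice_embed (vs ! Suc i - vs ! i)"
  have "[0] \<in> ?S" using assms by simp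
  then have "?f ` ?S \<noteq> {}" by blast
  from cInf_lessD[OF this assms(4)[unfolded control_value_def]] obtain vs where vs: "nn_path vs" "hd vs = 0" "path_weight \<tau> \<omega> vs \<le> t" "?f vs < c"
    by blast
  show thesis
  proof (rule that)
    show "passage_time \<tau> \<omega> 0 (last vs) \<le> t"
      using passage_time_le[OF assms(1,2) vs(1)] vs by simp
    show "p \<bullet> lattice_embed (last vs) < c"
      using sum_steps_telescope[OF vs(1), of p] vs by simp
  qed
qed

section \<open>Stationarity turns almost sure limits into frequent events\<close>

lemma (in prob_space) prob_tendsto_1:
  assumes "\<And>n. E n \<in> events" "AE \<omega> in M. \<forall>\<^sub>F n in sequentially. \<omega> \<in> E n"
  shows "(\<lambda>n. prob (E n)) \<longlonglongrightarrow> 1"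
proof -
  have "(\<lambda>n. \<integral>\<omega>. indicator (E n) \<omega> \<partial>M :: real) \<longlonglongrightarrow> (\<integral>\<omega>. 1 \<partial>M)"
  proof (rule integral_dominated_convergence[where w = "\<lambda>_. 1"])
    show "AE \<omega> in M. (\<lambda>n. indicator (E n) \<omega> :: real) \<longlonglongrightarrow> 1"
      using assms(2)
    proof eventually_elim
      case (elim \<omega>)
      show ?case
        by (rule tendsto_eventually) (use elim in \<open>auto elim: eventually_mono\<close>)
    qed
  qed (use assms(1) in \<open>auto simp: indicator_def\<close>)
  then show ?thesis
    using assms(1) by (simp add: prob_space)
qed

context stationary_ergodic_fpp
begin

text \<open>
  If the conclusion failed, almost every \<open>\<omega>\<close> would eventually belong to the union \<open>B n\<close> of the
  complements of the shifted events, so the probability of \<open>B n\<close> would tend to 1. But \<open>V\<close> preserves the measure,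
  so this probability is at most the sum of the probabilities of the complements of \<open>E i n\<close>, which
  tends to 0.
\<close>

lemma frequently_shifted:
  fixes E :: "'i \<Rightarrow> nat \<Rightarrow> 'w set"
  assumes I: "finite I"
    and E: "\<And>i n. i \<in> I \<Longrightarrow> E i n \<in> events"
    and ev: "\<And>i. i \<in> I \<Longrightarrow> AE \<omega> in M. \<forall>\<^sub>F n in sequentially. \<omega> \<in> E i n"
    and Q: "AE \<omega> in M. Q \<omega>"
  shows "\<exists>\<omega>\<in>space M. Q \<omega> \<and> (\<exists>\<^sub>F n in sequentially. \<forall>i\<in>I. V (z i n) \<omega> \<in> E i n)"
proof (rule ccontr)
  assume neg: "\<not> ?thesis"
  define C where "C i n = V (z i n) -` (space M - E i n) \<inter> space M" for i n
  define B where "B n = (\<Union>i\<in>I. C i n)" for n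
  have C: "C i n \<in> events" if "i \<in> I" for i n
    unfolding C_def using E[OF that] by (intro measurable_sets[OF V_measurable]) auto
  have probC: "prob (C i n) = 1 - prob (E i n)" if "i \<in> I" for i n
  proof -
    have "prob (C i n) = measure (distr M M (V (z i n))) (space M - E i n)"
      unfolding C_def using E[OF that] by (intro measure_distr[symmetric] V_measurable) auto
    then show ?thesis
      using prob_compl[OF E[OF that]] by (simp add: V_measure_preserving)
  qed
  have "(\<lambda>n. prob (B n)) \<longlonglongrightarrow> 1"
  proof (rule prob_tendsto_1)
    show "B n \<in> events" for n
      unfolding B_def using I C by auto
    show "AE \<omega> in M. \<forall>\<^sub>F n in sequentially. \<omega> \<in> B n"
      using Q AE_space
    proof eventually_elim
      case (elim \<omega>)
      then have "\<forall>\<^sub>F n in sequentially. \<exists>i\<in>I. V (z i n) \<omega> \<notin> E i n"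
        using neg by (auto simp: frequently_def)
      then show ?case
        by (rule eventually_mono)
          (use elim measurable_space[OF V_measurable] in \<open>auto simp: B_def C_def\<close>)
    qed
  qed
  moreover have "(\<lambda>n. prob (B n)) \<longlonglongrightarrow> 0"
  proof (rule tendsto_sandwich[of "\<lambda>_. 0"])
    have "(\<lambda>n. \<Sum>i\<in>I. 1 - prob (E i n)) \<longlonglongrightarrow> (\<Sum>i\<in>I. 1 - 1)"
      by (intro tendsto_sum tendsto_diff tendsto_const prob_tendsto_1 E ev)
    then show "(\<lambda>n. \<Sum>i\<in>I. 1 - prob (E i n)) \<longlonglongrightarrow> 0" by simp
    have "prob (B n) \<le> (\<Sum>i\<in>I. 1 - prob (E i n))" for n
    proof -
      have "prob (B n) \<le> (\<Sum>i\<in>I. prob (C i n))"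
        unfolding B_def using I C by (intro finite_measure_subadditive_finite) auto
      then show ?thesis using probC by simp
    qed
    then show "\<forall>\<^sub>F n in sequentially. prob (B n) \<le> (\<Sum>i\<in>I. 1 - prob (E i n))" by simp
  qed auto
  ultimately show False
    using LIMSEQ_unique by fastforce
qed

lemma AE_weights_between:
  obtains a b where "0 < a" "0 < b" "AE \<omega> in M. weights_between \<tau> a b \<omega>"
proof -
  obtain a where a: "0 < ereal a" "ereal a < weight_essinf M \<tau>"
    using ereal_dense2[OF weight_lower] by blast
  obtain b where b: "weight_esssup M \<tau> < ereal b"
    using ereal_dense2[OF weight_upper] by blast
  have lower: "AE \<omega> in M. a \<le> \<tau> x \<alpha> \<omega>" if \<alpha>: "\<alpha> \<in> unit_steps" for x \<alpha>
  proof -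
    have "weight_essinf M \<tau> \<le> (INF \<alpha>\<in>unit_steps. - esssup M (\<lambda>\<omega>. - ereal (\<tau> x \<alpha> \<omega>)))"
      unfolding weight_essinf_def by (rule INF_lower) simp
    also have "\<dots> \<le> - esssup M (\<lambda>\<omega>. - ereal (\<tau> x \<alpha> \<omega>))"
      using \<alpha> by (rule INF_lower)
    finally have le: "ereal a \<le> - esssup M (\<lambda>\<omega>. - ereal (\<tau> x \<alpha> \<omega>))"
      using a(2) by order
    have "AE \<omega> in M. - ereal (\<tau> x \<alpha> \<omega>) \<le> esssup M (\<lambda>\<omega>. - ereal (\<tau> x \<alpha> \<omega>))"
      by (rule esssup_AE)
    then show ?thesis
    proof eventually_elim
      case (elim \<omega>)
      then have "ereal a \<le> ereal (\<tau> x \<alpha> \<omega>)"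
        using le by (metis ereal_minus_le_minus ereal_uminus_uminus order_trans)
      then show ?case by simp
    qed
  qed
  have upper: "AE \<omega> in M. \<tau> x \<alpha> \<omega> \<le> max b 1" if \<alpha>: "\<alpha> \<in> unit_steps" for x \<alpha>
  proof -
    have "esssup M (\<lambda>\<omega>. ereal (\<tau> x \<alpha> \<omega>)) \<le> (SUP \<alpha>\<in>unit_steps. esssup M (\<lambda>\<omega>. ereal (\<tau> x \<alpha> \<omega>)))"
      using \<alpha> by (rule SUP_upper)
    also have "\<dots> \<le> weight_esssup M \<tau>"
      unfolding weight_esssup_def by (rule SUP_upper) simp
    finally have le: "esssup M (\<lambda>\<omega>. ereal (\<tau> x \<alpha> \<omega>)) \<le> ereal b"
      using b by order
    have "AE \<omega> in M. ereal (\<tau> x \<alpha> \<omega>) \<le> esssup M (\<lambda>\<omega>. ereal (\<tau> x \<alpha> \<omega>))"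
      by (rule esssup_AE)
    then show ?thesis
    proof eventually_elim
      case (elim \<omega>)
      then have "ereal (\<tau> x \<alpha> \<omega>) \<le> ereal b"
        using le by order
      then show ?case by simp
    qed
  qed
  have "AE \<omega> in M. \<forall>x. \<forall>\<alpha>. \<alpha> \<in> unit_steps \<longrightarrow> a \<le> \<tau> x \<alpha> \<omega> \<and> \<tau> x \<alpha> \<omega> \<le> max b 1"
    unfolding AE_all_countable using lower upper by auto
  then have "AE \<omega> in M. weights_between \<tau> a (max b 1) \<omega>"
    by (simp add: weights_between_def Ball_def)
  then show thesis
    using that[of a "max b 1"] a by simp
qed

lemma path_weight_shift:
  assumes "nn_path vs" "\<omega> \<in> space M"
  shows "path_weight \<tau> (V z \<omega>) vs = path_weight \<tau> \<omega> (map (\<lambda>v. v + z) vs)"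
  using assms(1)
  by (induction vs rule: nn_path_induct)
    (auto simp: path_weight_Cons weight_stationary assms(2))

lemma passage_time_shift:
  assumes "\<omega> \<in> space M"
  shows "passage_time \<tau> (V z \<omega>) x y = passage_time \<tau> \<omega> (x + z) (y + z)"
proof -
  let ?P = "\<lambda>x y. {vs. nn_path vs \<and> hd vs = x \<and> last vs = y}"
  have "(\<lambda>vs. map (\<lambda>v. v + z) vs) ` ?P x y = ?P (x + z) (y + z)"
  proof (intro equalityI subsetI)
    fix vs assume vs: "vs \<in> ?P (x + z) (y + z)"
    have "map (\<lambda>v. v - z) vs \<in> ?P x y"
      using nn_path_translate[of vs "- z"] vs by simp
    moreover have "vs = map (\<lambda>v. v + z) (map (\<lambda>v. v - z) vs)"
      by (simp add: comp_def)
    ultimately show "vs \<in> (\<lambda>vs. map (\<lambda>v. v + z) vs) ` ?P x y" by (rule rev_image_eqI)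
  qed (use nn_path_translate in auto)
  then have "passage_time \<tau> \<omega> (x + z) (y + z) =
      (INF vs\<in>?P x y. path_weight \<tau> \<omega> (map (\<lambda>v. v + z) vs))"
    unfolding passage_time_def by (metis image_image)
  also have "\<dots> = passage_time \<tau> (V z \<omega>) x y"
    unfolding passage_time_def using path_weight_shift[OF _ assms] by (intro INF_cong) auto
  finally show ?thesis by simp
qed

lemma sets_weights_between: "{\<omega> \<in> space M. weights_between \<tau> a b \<omega>} \<in> events"
proof -
  have "{\<omega> \<in> space M. \<forall>x. \<forall>\<alpha>. \<alpha> \<in> unit_steps \<longrightarrow> a \<le> \<tau> x \<alpha> \<omega> \<and> \<tau> x \<alpha> \<omega> \<le> b} \<in> events"
  proof (intro sets.sets_Collect_countable_All)
    fix x \<alpha>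
    show "{\<omega> \<in> space M. \<alpha> \<in> unit_steps \<longrightarrow> a \<le> \<tau> x \<alpha> \<omega> \<and> \<tau> x \<alpha> \<omega> \<le> b} \<in> events"
    proof (cases "\<alpha> \<in> unit_steps")
      case True
      note weight_measurable[OF True, measurable]
      show ?thesis using True by simp
    qed simp
  qed
  then show ?thesis by (simp add: weights_between_def Ball_def)
qed

text \<open>
  Without a lower bound on the weights, the real infimum over paths may be an unspecified value, so
  measurability is only claimed on the set of environments with bounded weights, where the passage time is an
  infimum of countably many measurable functions that is bounded below.
\<close>

lemma sets_passage_time:
  assumes "0 \<le> a" "A \<in> sets borel"
  shows "{\<omega> \<in> space M. weights_between \<tau> a b \<omega> \<and> passage_time \<tau> \<omega> x y \<in> A} \<in> events"
proof -
  let ?G = "{\<omega> \<in> space M. weights_between \<tau> a b \<omega>}"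
  let ?R = "restrict_space M ?G"
  have G: "?G \<inter> space M \<in> events" using sets_weights_between by auto
  have space_R: "space ?R = ?G" by (auto simp: space_restrict_space)
  have meas: "(\<lambda>\<omega>. path_weight \<tau> \<omega> vs) \<in> borel_measurable M" if "nn_path vs" for vs
    using that
  proof (induction vs rule: nn_path_induct)
    case (Cons v w vs)
    note Cons.IH[measurable] weight_measurable[OF Cons.hyps(1), measurable]
    show ?case by (simp add: path_weight_Cons)
  qed simp
  have "(\<lambda>\<omega>. passage_time \<tau> \<omega> x y) \<in> borel_measurable ?R"
    unfolding passage_time_def
  proof (rule borel_measurable_cINF)
    show "bdd_below ((\<lambda>vs. path_weight \<tau> \<omega> vs) ` {vs. nn_path vs \<and> hd vs = x \<and> last vs = y})"
      if "\<omega> \<in> space ?R" for \<omega>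
      using passage_time_bdd_below[of \<tau> a b \<omega>] that assms space_R by auto
  qed (use meas in \<open>auto intro: measurable_restrict_space1\<close>)
  from measurable_sets[OF this assms(2)]
  have "(\<lambda>\<omega>. passage_time \<tau> \<omega> x y) -` A \<inter> ?G \<in> events"
    unfolding sets_restrict_space_iff[OF G] space_R by simp
  moreover have "(\<lambda>\<omega>. passage_time \<tau> \<omega> x y) -` A \<inter> ?G =
      {\<omega> \<in> space M. weights_between \<tau> a b \<omega> \<and> passage_time \<tau> \<omega> x y \<in> A}" by auto
  ultimately show ?thesis by simp
qed

end


section \<open>The time constant is a norm\<close>

lemma passage_time_diff:
  fixes x y :: "int ^ 'd::finite"
  assumes "weights_between \<tau> a b \<omega>" "0 \<le> a" "0 \<le> b"
  shows "\<bar>passage_time \<tau> \<omega> x z - passage_time \<tau> \<omega> y z\<bar> \<le>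
    b * real CARD('d) * norm (lattice_embed x - lattice_embed y)"
  using passage_time_triangle[OF assms(1,2), of x z y] passage_time_triangle[OF assms(1,2), of y z x]
    passage_time_upper[OF assms, of x y] passage_time_upper[OF assms, of y x]
  by (simp add: norm_minus_commute)

text \<open>
  One choice of almost sure bounds on the weights is fixed along with the time constant, since all
  estimates below are in terms of these bounds.
\<close>

locale fpp_time_constant = stationary_ergodic_fpp M V \<tau>
  for M :: "'w measure" and V :: "int ^ 'd::finite \<Rightarrow> 'w \<Rightarrow> 'w" and \<tau> :: "('d, 'w) weights" +
  fixes nr :: "real ^ 'd \<Rightarrow> 'w \<Rightarrow> int ^ 'd"
    and m :: "real ^ 'd \<Rightarrow> real"
    and a b :: real
  assumes nearest: "nearest_lattice_point M nr"
    and time_constant: "is_time_constant M \<tau> nr m"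
    and a_pos: "0 < a" and b_pos: "0 < b"
    and weights: "AE \<omega> in M. weights_between \<tau> a b \<omega>"
begin

abbreviation L :: "nat \<Rightarrow> real ^ 'd \<Rightarrow> int ^ 'd" where
  "L n x \<equiv> lattice_floor (real n *\<^sub>R x)"

text \<open>
  Moving the starting point by a bounded amount changes a passage time by a bounded amount, which
  disappears after division by \<open>n\<close>. Therefore the rounding rule, which may depend on
  \<open>\<omega>\<close>, can be exchanged for any deterministic one. This is what makes shifts of the environment
  applicable: the lattice points to be shifted must not depend on \<open>\<omega>\<close>.
\<close>

lemma AE_passage_time_tendsto:
  assumes u: "\<And>n. norm (lattice_embed (u n) - real n *\<^sub>R x) \<le> C"
  shows "AE \<omega> in M. (\<lambda>n. passage_time \<tau> \<omega> (u n) 0 / real n) \<longlonglongrightarrow> m x"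
proof -
  have "AE \<omega> in M. (\<lambda>n. passage_time \<tau> \<omega> (nr (real n *\<^sub>R x) \<omega>) 0 / real n) \<longlonglongrightarrow> m x"
    using time_constant by (simp add: is_time_constant_def)
  then show ?thesis
    using weights AE_space
  proof eventually_elim
    case (elim \<omega>)
    define v where "v n = nr (real n *\<^sub>R x) \<omega>" for n
    let ?T = "\<lambda>y. passage_time \<tau> \<omega> y 0"
    have lim: "(\<lambda>n. ?T (v n) / real n) \<longlonglongrightarrow> m x"
      using elim by (simp add: v_def)
    have v: "norm (real n *\<^sub>R x - lattice_embed (v n)) \<le> real CARD('d)" for n
    proof -
      have "norm (real n *\<^sub>R x - lattice_embed (v n)) \<le> norm (real n *\<^sub>R x - lattice_embed (L n x))"
        using nearest elim(3) unfolding nearest_lattice_point_def v_def dist_norm by blast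
      also have "\<dots> \<le> real CARD('d)" using norm_lattice_floor by (metis norm_minus_commute)
      finally show ?thesis .
    qed
    have diff: "\<bar>?T (u n) - ?T (v n)\<bar> \<le> b * real CARD('d) * (C + real CARD('d))" for n
    proof -
      have "norm (lattice_embed (u n) - lattice_embed (v n)) \<le> C + real CARD('d)"
        using norm_triangle_mono[OF u[of n] v[of n]] by simp
      then have "b * real CARD('d) * norm (lattice_embed (u n) - lattice_embed (v n)) \<le> b * real CARD('d) * (C + real CARD('d))"
        using b_pos by (intro mult_left_mono) auto
      then show ?thesis
        using a_pos b_pos by (intro order_trans[OF passage_time_diff[OF elim(2)]]) auto
    qed
    have "(\<lambda>n. (?T (u n) - ?T (v n)) / real n) \<longlonglongrightarrow> 0"
    proof (rule Lim_null_comparison)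
      show "\<forall>\<^sub>F n in sequentially. norm ((?T (u n) - ?T (v n)) / real n) \<le> b * real CARD('d) * (C + real CARD('d)) / real n"
        using diff by (auto simp: abs_divide intro!: always_eventually divide_right_mono)
      show "(\<lambda>n. b * real CARD('d) * (C + real CARD('d)) / real n) \<longlonglongrightarrow> 0" by (rule lim_const_over_n)
    qed
    from tendsto_add[OF this lim] show ?case by (simp add: diff_divide_distrib)
  qed
qed

lemma AE_passage_time_floor:
  "AE \<omega> in M. (\<lambda>n. passage_time \<tau> \<omega> (L n x) 0 / real n) \<longlonglongrightarrow> m x"
  by (rule AE_passage_time_tendsto) (rule norm_lattice_floor)

text \<open>
  By stationarity, the limit of \<open>passage_time \<tau> \<omega> (L n x) 0 / n\<close> governs also the
  passage times between the translated points \<open>L n x + z x n\<close> and \<open>z x n\<close>. As the translation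
  changes with \<open>n\<close>, almost sure convergence is lost, but for a single \<open>\<omega>\<close> the translated
  times are still close to the limit for infinitely many \<open>n\<close>, for all \<open>x\<close> in a finite set at once.
  That \<open>\<omega>\<close> can be taken from any given event \<open>Q\<close> of full probability, so that the limits known
  almost surely are available along the same subsequence.
\<close>

lemma frequently_near_time_constant:
  assumes "finite I" "0 < e" "AE \<omega> in M. Q \<omega>"
  obtains \<omega> where "weights_between \<tau> a b \<omega>" "Q \<omega>"
    "\<exists>\<^sub>F n in sequentially. \<forall>x\<in>I.
      \<bar>passage_time \<tau> \<omega> (L n x + z x n) (z x n) / real n - m x\<bar> < e"
proof -
  define E where "E x n = {\<omega> \<in> space M. weights_between \<tau> a b \<omega> \<and>
    passage_time \<tau> \<omega> (L n x) 0 \<in> {t. \<bar>t / real n - m x\<bar> < e}}" for x n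
  have E: "E x n \<in> events" for x n
    unfolding E_def using a_pos by (intro sets_passage_time) simp_all
  have ev: "AE \<omega> in M. \<forall>\<^sub>F n in sequentially. \<omega> \<in> E x n" for x
    using AE_passage_time_floor[of x] weights AE_space
  proof eventually_elim
    case (elim \<omega>)
    show ?case
      using tendstoD[OF elim(1) \<open>0 < e\<close>]
      by (rule eventually_mono) (use elim in \<open>auto simp: E_def dist_real_def\<close>)
  qed
  have "AE \<omega> in M. weights_between \<tau> a b \<omega> \<and> Q \<omega>"
    using weights assms(3) by eventually_elim simp
  from frequently_shifted[where E = E and z = z, OF assms(1) E ev this]
  obtain \<omega> where \<omega>: "\<omega> \<in> space M" "weights_between \<tau> a b \<omega>" "Q \<omega>"
    "\<exists>\<^sub>F n in sequentially. \<forall>x\<in>I. V (z x n) \<omega> \<in> E x n"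
    by blast
  show thesis
  proof (rule that[OF \<omega>(2,3)])
    show "\<exists>\<^sub>F n in sequentially. \<forall>x\<in>I.
        \<bar>passage_time \<tau> \<omega> (L n x + z x n) (z x n) / real n - m x\<bar> < e"
      using \<omega>(4) by (rule frequently_elim1) (auto simp: E_def passage_time_shift[OF \<omega>(1)])
  qed
qed

lemma time_constant_ge: "a * norm x \<le> m x"
proof -
  have "AE \<omega> in M. a * norm x \<le> m x"
    using AE_passage_time_floor[of x] weights
  proof eventually_elim
    case (elim \<omega>)
    have "(\<lambda>n. a * (norm x - real CARD('d) / real n)) \<longlonglongrightarrow> a * (norm x - 0)"
      by (intro tendsto_intros lim_const_over_n)
    moreover have "\<forall>\<^sub>F n in sequentially.
        a * (norm x - real CARD('d) / real n) \<le> passage_time \<tau> \<omega> (L n x) 0 / real n"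
      using eventually_gt_at_top[of 0]
    proof eventually_elim
      case (elim n)
      have "real n * norm x - real CARD('d) \<le> norm (lattice_embed (L n x))"
        using norm_lattice_floor[of "real n *\<^sub>R x"]
          norm_triangle_ineq2[of "real n *\<^sub>R x" "lattice_embed (L n x)"]
        by (simp add: norm_minus_commute)
      then have "a * (real n * norm x - real CARD('d)) \<le> a * norm (lattice_embed (L n x))"
        using a_pos by simp
      also have "\<dots> \<le> passage_time \<tau> \<omega> (L n x) 0"
        using passage_time_ge[OF \<open>weights_between \<tau> a b \<omega>\<close>, of "L n x" 0] a_pos by simp
      finally have "a * (real n * norm x - real CARD('d)) / real n \<le> passage_time \<tau> \<omega> (L n x) 0 / real n"
        by (rule divide_right_mono) simp
      then show ?case using elim by (simp add: field_simps)
    qed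
    ultimately show ?case
      using tendsto_le[OF _ elim(1)] by simp
  qed
  then show ?thesis by simp
qed

lemma time_constant_0: "m 0 = 0"
proof -
  have "AE \<omega> in M. m 0 \<le> 0"
    using AE_passage_time_tendsto[of "\<lambda>_. 0" 0 0, simplified] weights
  proof eventually_elim
    case (elim \<omega>)
    have "passage_time \<tau> \<omega> 0 0 \<le> 0"
      using passage_time_upper[OF elim(2), of 0 0] a_pos b_pos by simp
    then show ?case
      by (intro LIMSEQ_le_const2[OF elim(1)]) (auto simp: divide_nonpos_nonneg)
  qed
  then show ?thesis using time_constant_ge[of 0] by simp
qed

lemma time_constant_pos: "x \<noteq> 0 \<Longrightarrow> 0 < m x"
  using time_constant_ge[of x] a_pos by (smt (verit) mult_pos_pos zero_less_norm_iff)

text \<open>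
  Real factors need no detour through rational ones: the points \<open>L \<lfloor>n c\<rfloor> x\<close> stay at bounded distance
  from \<open>n c x\<close>, and their passage times divided by \<open>\<lfloor>n c\<rfloor>\<close> are
  terms, with index tending to infinity, of a sequence that converges to \<open>m x\<close>.
\<close>

lemma time_constant_scale:
  assumes "0 < c"
  shows "m (c *\<^sub>R x) = c * m x"
proof -
  define N where "N n = nat \<lfloor>real n * c\<rfloor>" for n
  have N: "\<bar>real (N n) - real n * c\<bar> \<le> 1" for n
  proof -
    have "real (N n) = real_of_int \<lfloor>real n * c\<rfloor>"
      using assms by (simp add: N_def)
    then show ?thesis by linarith
  qed
  have near: "norm (lattice_embed (L (N n) x) - real n *\<^sub>R (c *\<^sub>R x)) \<le> real CARD('d) + norm x" for n
  proof -
    have "norm (real (N n) *\<^sub>R x - real n *\<^sub>R (c *\<^sub>R x)) = \<bar>real (N n) - real n * c\<bar> * norm x"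
      by (simp flip: norm_scaleR scaleR_diff_left)
    also have "\<dots> \<le> 1 * norm x" by (intro mult_right_mono N) simp
    finally show ?thesis
      using norm_triangle_mono[OF norm_lattice_floor[of "real (N n) *\<^sub>R x"]] by fastforce
  qed
  \<comment> \<open>The offset by 1 keeps the denominator away from 0.\<close>
  have lim_N: "(\<lambda>n. real (N n) / real n) \<longlonglongrightarrow> c"
  proof (rule LIMSEQ_offset, rule Lim_transform2)
    show "(\<lambda>n. c) \<longlonglongrightarrow> c" by simp
    show "(\<lambda>n. c - real (N (n + 1)) / real (n + 1)) \<longlonglongrightarrow> 0"
    proof (rule Lim_null_comparison)
      show "\<forall>\<^sub>F n in sequentially. norm (c - real (N (n + 1)) / real (n + 1)) \<le> 1 / real (n + 1)"
      proof (rule always_eventually, rule allI)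
        fix n
        have "c - real (N (n + 1)) / real (n + 1) = - (real (N (n + 1)) - real (n + 1) * c) / real (n + 1)"
          by (simp add: field_simps)
        then show "norm (c - real (N (n + 1)) / real (n + 1)) \<le> 1 / real (n + 1)"
          using N[of "n + 1"] by (simp add: abs_divide divide_right_mono del: of_nat_Suc of_nat_add)
      qed
      show "(\<lambda>n. 1 / real (n + 1)) \<longlonglongrightarrow> 0" by (rule LIMSEQ_ignore_initial_segment[OF lim_const_over_n])
    qed
  qed
  have N_top: "filterlim N sequentially sequentially"
  proof -
    have "filterlim (\<lambda>n. - 1 + c * real n) at_top sequentially"
      using assms by (intro filterlim_tendsto_add_at_top[OF tendsto_const]
          filterlim_tendsto_pos_mult_at_top[OF tendsto_const] filterlim_real_sequentially)
    then have "filterlim (\<lambda>n. real (N n)) at_top sequentially"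
      by (rule filterlim_at_top_mono) (use N in \<open>auto simp: abs_le_iff mult.commute algebra_simps\<close>)
    then show ?thesis
      by (simp add: filterlim_sequentially_iff_filterlim_real)
  qed
  have "AE \<omega> in M. m (c *\<^sub>R x) = c * m x"
    using AE_passage_time_floor[of x] AE_passage_time_tendsto[OF near]
  proof eventually_elim
    case (elim \<omega>)
    let ?T = "\<lambda>n. passage_time \<tau> \<omega> (L (N n) x) 0"
    have "(\<lambda>n. ?T n / real (N n) * (real (N n) / real n)) \<longlonglongrightarrow> m x * c"
      by (intro tendsto_mult lim_N filterlim_compose[OF elim(1) N_top])
    moreover have "\<forall>\<^sub>F n in sequentially. ?T n / real (N n) * (real (N n) / real n) = ?T n / real n"
      using eventually_compose_filterlim[OF eventually_gt_at_top[of 0] N_top]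
      by eventually_elim simp
    ultimately have "(\<lambda>n. ?T n / real n) \<longlonglongrightarrow> m x * c"
      by (rule Lim_transform_eventually)
    then show ?case
      using LIMSEQ_unique[OF elim(2)] by (simp add: mult.commute)
  qed
  then show ?thesis by simp
qed

text \<open>
  A path from \<open>n (x + y)\<close> to \<open>0\<close> may be required to pass through \<open>n y\<close>. Its second part has
  almost surely the limit \<open>m y\<close>, and its first part is the passage time from \<open>n x\<close> to \<open>0\<close>
  translated by \<open>n y\<close>.
\<close>

lemma time_constant_add: "m (x + y) \<le> m x + m y"
proof (rule field_le_epsilon)
  fix e :: real assume "0 < e"
  \<comment> \<open>One share of the error for each of the three passage times and one for the rounding.\<close>
  define d where "d = e / 4"
  have d: "0 < d" using \<open>0 < e\<close> by (simp add: d_def)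
  have "AE \<omega> in M. (\<lambda>n. passage_time \<tau> \<omega> (L n y) 0 / real n) \<longlonglongrightarrow> m y \<and>
      (\<lambda>n. passage_time \<tau> \<omega> (L n (x + y)) 0 / real n) \<longlonglongrightarrow> m (x + y)"
    using AE_passage_time_floor[of y] AE_passage_time_floor[of "x + y"] by eventually_elim simp
  from frequently_near_time_constant[where I = "{x}" and z = "\<lambda>_ n. L n y", OF _ d this]
  obtain \<omega> where \<omega>: "weights_between \<tau> a b \<omega>"
    and lim_y: "(\<lambda>n. passage_time \<tau> \<omega> (L n y) 0 / real n) \<longlonglongrightarrow> m y"
    and lim_xy: "(\<lambda>n. passage_time \<tau> \<omega> (L n (x + y)) 0 / real n) \<longlonglongrightarrow> m (x + y)"
    and fr: "\<exists>\<^sub>F n in sequentially.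
      \<bar>passage_time \<tau> \<omega> (L n x + L n y) (L n y) / real n - m x\<bar> < d"
    by auto
  have "\<forall>\<^sub>F n in sequentially. \<bar>passage_time \<tau> \<omega> (L n y) 0 / real n - m y\<bar> < d \<and>
      \<bar>passage_time \<tau> \<omega> (L n (x + y)) 0 / real n - m (x + y)\<bar> < d \<and>
      b * real CARD('d) * (3 * real CARD('d)) / real n < d \<and> 0 < n"
    using tendstoD[OF lim_y d] tendstoD[OF lim_xy d]
      order_tendstoD(2)[OF lim_const_over_n[of "b * real CARD('d) * (3 * real CARD('d))"] d] eventually_gt_at_top[of 0]
    by eventually_elim (simp add: dist_real_def)
  from frequently_ex[OF frequently_eventually_frequently[OF fr this]]
  obtain n where n: "\<bar>passage_time \<tau> \<omega> (L n x + L n y) (L n y) / real n - m x\<bar> < d"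
    "\<bar>passage_time \<tau> \<omega> (L n y) 0 / real n - m y\<bar> < d"
    "\<bar>passage_time \<tau> \<omega> (L n (x + y)) 0 / real n - m (x + y)\<bar> < d"
    "b * real CARD('d) * (3 * real CARD('d)) / real n < d" "0 < n"
    by auto
  have "lattice_embed (L n (x + y)) - lattice_embed (L n x + L n y) =
      (lattice_embed (L n (x + y)) - real n *\<^sub>R (x + y)) -
      (lattice_embed (L n x) - real n *\<^sub>R x) - (lattice_embed (L n y) - real n *\<^sub>R y)"
    by (simp add: algebra_simps)
  also have "norm \<dots> \<le> real CARD('d) + real CARD('d) + real CARD('d)"
    by (intro norm_triangle_le_diff order_trans[OF norm_triangle_ineq4] add_mono norm_lattice_floor)
  finally have "b * real CARD('d) * norm (lattice_embed (L n (x + y)) - lattice_embed (L n x + L n y)) \<le>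
      b * real CARD('d) * (3 * real CARD('d))"
    using b_pos by (intro mult_left_mono) auto
  moreover have "passage_time \<tau> \<omega> (L n (x + y)) 0 - passage_time \<tau> \<omega> (L n x + L n y) 0 \<le>
      b * real CARD('d) * norm (lattice_embed (L n (x + y)) - lattice_embed (L n x + L n y))"
    using passage_time_diff[OF \<omega>, of "L n (x + y)" 0 "L n x + L n y"] a_pos b_pos by simp
  ultimately have "passage_time \<tau> \<omega> (L n (x + y)) 0 \<le>
      b * real CARD('d) * (3 * real CARD('d)) + passage_time \<tau> \<omega> (L n x + L n y) (L n y) + passage_time \<tau> \<omega> (L n y) 0"
    using passage_time_triangle[OF \<omega>, of "L n x + L n y" 0 "L n y"] a_pos by linarith
  then have "passage_time \<tau> \<omega> (L n (x + y)) 0 / real n \<le>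
      b * real CARD('d) * (3 * real CARD('d)) / real n + passage_time \<tau> \<omega> (L n x + L n y) (L n y) / real n +
      passage_time \<tau> \<omega> (L n y) 0 / real n"
    using n(5) by (simp add: divide_right_mono flip: add_divide_distrib)
  then show "m (x + y) \<le> m x + m y + e"
    using n(1-4) d_def unfolding abs_less_iff by linarith
qed

lemma is_norm_time_constant: "is_norm m"
proof -
  have "convex_on UNIV m"
  proof (rule convex_onI)
    fix t :: real and x y :: "real ^ 'd"
    assume "0 < t" "t < 1"
    then show "m ((1 - t) *\<^sub>R x + t *\<^sub>R y) \<le> (1 - t) * m x + t * m y"
      using time_constant_add[of "(1 - t) *\<^sub>R x" "t *\<^sub>R y"] by (simp add: time_constant_scale)
  qed simp
  then show ?thesis
    using time_constant_scale time_constant_0 time_constant_pos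
    unfolding is_norm_def by (metis less_irrefl)
qed

section \<open>Duality with the limiting Hamiltonian\<close>

text \<open>
  The control problem starts at \<open>0\<close>, whereas the time constant measures paths that end at
  \<open>0\<close>. Translation by \<open>- L n x\<close> turns a path from \<open>L n x\<close> to \<open>0\<close> into one from \<open>0\<close> to
  \<open>- L n x\<close>. With the time budget \<open>n (m x + d)\<close> the controller can reach \<open>- L n x\<close>, where the cost is about
  \<open>- n (p \<bullet> x)\<close>.
\<close>

lemma inner_le_hamiltonian:
  assumes "AE \<omega> in M. ((\<lambda>t. - (control_value \<tau> p 0 t \<omega> / t)) \<longlongrightarrow> h) at_top"
  shows "p \<bullet> x \<le> h * m x"
proof -
  have m_nonneg: "0 \<le> m x"
    using time_constant_ge[of x] a_pos by (smt (verit) mult_nonneg_nonneg norm_ge_zero)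
  have bound: "p \<bullet> x \<le> (h + d) * (m x + d) + d" if d: "0 < d" for d
  proof -
    define c where "c = m x + d"
    have c: "0 < c" using m_nonneg d by (simp add: c_def)
    from frequently_near_time_constant[where I = "{x}" and z = "\<lambda>x n. - L n x", OF _ d assms]
    obtain \<omega> where \<omega>: "weights_between \<tau> a b \<omega>"
      and lim: "((\<lambda>t. - (control_value \<tau> p 0 t \<omega> / t)) \<longlongrightarrow> h) at_top"
      and fr: "\<exists>\<^sub>F n in sequentially. \<bar>passage_time \<tau> \<omega> 0 (- L n x) / real n - m x\<bar> < d"
      by auto
    have "filterlim (\<lambda>n. c * real n) at_top sequentially"
      using c by (intro filterlim_tendsto_pos_mult_at_top[OF tendsto_const] filterlim_real_sequentially)
    from filterlim_compose[OF lim this]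
    have "\<forall>\<^sub>F n in sequentially. - (control_value \<tau> p 0 (c * real n) \<omega> / (c * real n)) < h + d"
      by (rule order_tendstoD) (use d in simp)
    then have "\<forall>\<^sub>F n in sequentially.
        - (control_value \<tau> p 0 (c * real n) \<omega> / (c * real n)) < h + d \<and>
        norm p * real CARD('d) / real n < d \<and> 0 < n"
      using order_tendstoD(2)[OF lim_const_over_n[of "norm p * real CARD('d)"] d] eventually_gt_at_top[of 0]
      by eventually_elim simp
    from frequently_ex[OF frequently_eventually_frequently[OF fr this]]
    obtain n where near: "\<bar>passage_time \<tau> \<omega> 0 (- L n x) / real n - m x\<bar> < d"
      and n:
      "- (control_value \<tau> p 0 (c * real n) \<omega> / (c * real n)) < h + d"
      "norm p * real CARD('d) / real n < d" "0 < n"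
      by blast
    have "passage_time \<tau> \<omega> 0 (- L n x) / real n < c"
      using near unfolding c_def by linarith
    then have "passage_time \<tau> \<omega> 0 (- L n x) < c * real n"
      using n(3) by (simp add: field_simps)
    from control_value_le[OF \<omega> a_pos this, of p]
    have "p \<bullet> lattice_embed (L n x) \<le> - control_value \<tau> p 0 (c * real n) \<omega>" by simp
    also have "\<dots> < (h + d) * (c * real n)"
      using n(1,3) c by (simp add: field_simps)
    finally have 1: "p \<bullet> lattice_embed (L n x) < (h + d) * (c * real n)" .
    have "\<bar>p \<bullet> (lattice_embed (L n x) - real n *\<^sub>R x)\<bar> \<le>
        norm p * norm (lattice_embed (L n x) - real n *\<^sub>R x)"
      by (rule Cauchy_Schwarz_ineq2)
    also have "\<dots> \<le> norm p * real CARD('d)" by (intro mult_left_mono norm_lattice_floor) simp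
    finally have "real n * (p \<bullet> x) \<le> p \<bullet> lattice_embed (L n x) + norm p * real CARD('d)"
      by (simp add: inner_diff_right)
    also have "\<dots> < (h + d) * (c * real n) + d * real n"
      using 1 n(2,3) by (simp add: field_simps)
    also have "\<dots> = real n * ((h + d) * c + d)" by (simp add: algebra_simps)
    finally show ?thesis using n(3) by (simp add: c_def)
  qed
  have "((\<lambda>d. (h + d) * (m x + d) + d) \<longlongrightarrow> (h + 0) * (m x + 0) + 0) (at_right 0)"
    by (intro tendsto_intros)
  then have lim: "((\<lambda>d. (h + d) * (m x + d) + d) \<longlongrightarrow> h * m x) (at_right 0)" by simp
  show ?thesis
    by (rule tendsto_lowerbound[OF lim]) (auto simp: eventually_at_filter bound)
qed

text \<open>
  A nearly optimal path with time budget \<open>n\<close> ends at some \<open>v\<close>, and \<open>y = - v / n\<close> lies in the ball of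
  radius \<open>1 / a\<close>, since every step takes at least time \<open>a\<close>. It has to be shown that \<open>m y\<close> is
  essentially at most 1. As \<open>y\<close> depends on \<open>n\<close> and \<open>\<omega>\<close>, the limit that defines \<open>m y\<close>
  cannot be applied to it directly. It is applied to the finitely many points of a net of the ball
  instead, and the upper bound \<open>b\<close> on the weights controls the error of passing from \<open>y\<close> to
  a nearby point of the net.
\<close>

lemma hamiltonian_le:
  assumes H: "AE \<omega> in M. ((\<lambda>t. - (control_value \<tau> p 0 t \<omega> / t)) \<longlongrightarrow> h) at_top"
    and S: "\<And>x. p \<bullet> x \<le> S * m x"
  shows "h \<le> S"
proof -
  have S_nonneg: "0 \<le> S"
  proof -
    obtain x :: "real ^ 'd" where "x \<noteq> 0"
      by (metis axis_eq_0_iff zero_neq_one)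
    then have "0 < m x + m (- x)"
      using time_constant_pos[of x] time_constant_pos[of "- x"] by simp
    moreover have "0 \<le> S * (m x + m (- x))"
      using S[of x] S[of "- x"] by (simp add: distrib_left)
    ultimately show ?thesis by (simp add: zero_le_mult_iff)
  qed
  have bound: "h \<le> S * (1 + d + 2 * b * real CARD('d) * d) + d + norm p * d" if d: "0 < d" for d
  proof -
    have "seq_compact (cball 0 (1 / a) :: (real ^ 'd) set)"
      using compact_cball compact_imp_seq_compact by blast
    from seq_compact_imp_totally_bounded[OF this] d
    obtain K :: "(real ^ 'd) set" where K: "finite K" "cball 0 (1 / a) \<subseteq> (\<Union>x\<in>K. ball x d)"
      by metis
    from frequently_near_time_constant[where I = K and z = "\<lambda>x n. - L n x", OF K(1) d H]
    obtain \<omega> where \<omega>: "weights_between \<tau> a b \<omega>"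
      and lim: "((\<lambda>t. - (control_value \<tau> p 0 t \<omega> / t)) \<longlongrightarrow> h) at_top"
      and fr: "\<exists>\<^sub>F n in sequentially. \<forall>x\<in>K. \<bar>passage_time \<tau> \<omega> 0 (- L n x) / real n - m x\<bar> < d"
      by auto
    from filterlim_compose[OF lim filterlim_real_sequentially]
    have "\<forall>\<^sub>F n in sequentially. h - d < - (control_value \<tau> p 0 (real n) \<omega> / real n)"
      by (rule order_tendstoD) (use d in simp)
    then have "\<forall>\<^sub>F n in sequentially. h - d < - (control_value \<tau> p 0 (real n) \<omega> / real n) \<and>
        real CARD('d) / real n < d \<and> 0 < n"
      using order_tendstoD(2)[OF lim_const_over_n[of "real CARD('d)"] d] eventually_gt_at_top[of 0]
      by eventually_elim simp
    from frequently_ex[OF frequently_eventually_frequently[OF fr this]]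
    obtain n where n: "\<forall>x\<in>K. \<bar>passage_time \<tau> \<omega> 0 (- L n x) / real n - m x\<bar> < d"
      "h - d < - (control_value \<tau> p 0 (real n) \<omega> / real n)" "real CARD('d) / real n < d" "0 < n"
      by auto
    have "control_value \<tau> p 0 (real n) \<omega> < - (real n * (h - d))"
      using n(2,4) by (simp add: field_simps)
    from control_value_less_endpoint[OF \<omega> _ _ this] a_pos
    obtain v where v: "passage_time \<tau> \<omega> 0 v \<le> real n" "p \<bullet> lattice_embed v < - (real n * (h - d))"
      by auto
    define y where "y = - (1 / real n) *\<^sub>R lattice_embed v"
    have v_y: "lattice_embed v = - (real n *\<^sub>R y)" using n(4) by (simp add: y_def)
    have "a * (real n * norm y) \<le> real n"
      using passage_time_ge[OF \<omega>, of 0 v] a_pos v(1) by (simp add: v_y)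
    then have "norm y \<le> 1 / a"
      using n(4) a_pos by (simp add: field_simps)
    then obtain x where x: "x \<in> K" "norm (x - y) < d"
      using K(2) by (auto simp: dist_norm)
    have "real n * (h - d) < real n * (p \<bullet> y)" using v(2) by (simp add: v_y)
    then have "h - d < p \<bullet> y" using n(4) by simp
    moreover have "p \<bullet> (y - x) \<le> norm p * d"
    proof -
      have "p \<bullet> (y - x) \<le> norm p * norm (y - x)" by (rule norm_cauchy_schwarz)
      also have "\<dots> \<le> norm p * d"
        using x(2) by (intro mult_left_mono) (simp_all add: norm_minus_commute)
      finally show ?thesis .
    qed
    ultimately have h: "h \<le> p \<bullet> x + d + norm p * d" by (simp add: inner_diff_right)
    have "norm (lattice_embed v - lattice_embed (- L n x)) \<le> real n * (2 * d)"
    proof -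
      have "lattice_embed v - lattice_embed (- L n x) =
          (lattice_embed (L n x) - real n *\<^sub>R x) + real n *\<^sub>R (x - y)"
        by (simp add: v_y algebra_simps)
      also have "norm \<dots> \<le> real CARD('d) + real n * norm (x - y)"
        using norm_triangle_mono[OF norm_lattice_floor order_refl, of "real n *\<^sub>R x" "real n *\<^sub>R (x - y)"]
        by simp
      also have "\<dots> \<le> real n * d + real n * d"
        using n(3,4) x(2) by (intro add_mono mult_left_mono) (simp_all add: field_simps)
      finally show ?thesis by (simp add: algebra_simps)
    qed
    then have "b * real CARD('d) * norm (lattice_embed v - lattice_embed (- L n x)) \<le> b * real CARD('d) * (real n * (2 * d))"
      using b_pos by (intro mult_left_mono) auto
    then have "passage_time \<tau> \<omega> v (- L n x) \<le> b * real CARD('d) * (real n * (2 * d))"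
      using a_pos b_pos by (intro order_trans[OF passage_time_upper[OF \<omega>]]) auto
    then have "passage_time \<tau> \<omega> 0 (- L n x) \<le> real n * (1 + 2 * b * real CARD('d) * d)"
      using passage_time_triangle[OF \<omega>, of 0 "- L n x" v] a_pos v(1) by (simp add: algebra_simps)
    then have "passage_time \<tau> \<omega> 0 (- L n x) / real n \<le> 1 + 2 * b * real CARD('d) * d"
      using n(4) by (simp add: field_simps)
    moreover have "\<bar>passage_time \<tau> \<omega> 0 (- L n x) / real n - m x\<bar> < d" using n(1) x(1) by blast
    ultimately have "m x \<le> 1 + d + 2 * b * real CARD('d) * d" by linarith
    from order_trans[OF S mult_left_mono[OF this S_nonneg]] h show ?thesis by simp
  qed
  have "((\<lambda>d. S * (1 + d + 2 * b * real CARD('d) * d) + d + norm p * d) \<longlongrightarrow>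
      S * (1 + 0 + 2 * b * real CARD('d) * 0) + 0 + norm p * 0) (at_right 0)"
    by (intro tendsto_intros)
  then have lim: "((\<lambda>d. S * (1 + d + 2 * b * real CARD('d) * d) + d + norm p * d) \<longlongrightarrow> S) (at_right 0)" by simp
  show ?thesis
    by (rule tendsto_lowerbound[OF lim]) (auto simp: eventually_at_filter bound)
qed

end

lemma inner_le_if_unit_sphere:
  assumes "is_norm N" "\<And>x. 0 \<le> N x" "\<And>x. N x = 1 \<Longrightarrow> p \<bullet> x \<le> S"
  shows "p \<bullet> x \<le> S * N x"
proof (cases "x = 0")
  case True
  then have "N x = 0" using assms(1) by (simp add: is_norm_def)
  with True show ?thesis by simp
next
  case False
  then have pos: "0 < N x"
    using assms(1,2) by (metis is_norm_def order_less_le)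
  then have "N ((1 / N x) *\<^sub>R x) = 1"
    using assms(1) unfolding is_norm_def by (metis nonzero_divide_eq_eq order_less_irrefl zero_less_divide_1_iff)
  from assms(3)[OF this] show ?thesis
    using pos by (simp add: field_simps)
qed

text \<open>
  The two properties \<open>le\<close> and \<open>least\<close> say that \<open>h p\<close> is the least \<open>S\<close> with
  \<open>p \<bullet> x \<le> S * N x\<close> for all \<open>x\<close>, and such a least constant is sublinear in \<open>p\<close>. Testing
  with \<open>x = p\<close> shows that it does not vanish for \<open>p \<noteq> 0\<close>.
\<close>

lemma is_norm_dual:
  fixes N h :: "'a::real_inner \<Rightarrow> real"
  assumes le: "\<And>p x. p \<bullet> x \<le> h p * N x"
    and least: "\<And>p S. (\<And>x. p \<bullet> x \<le> S * N x) \<Longrightarrow> h p \<le> S"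
    and pos: "\<And>x. x \<noteq> 0 \<Longrightarrow> 0 < N x"
  shows "is_norm h"
proof -
  have scale_le: "h (c *\<^sub>R p) \<le> c * h p" if "0 < c" for c p
    by (rule least) (use le[of p] that in \<open>simp add: mult.assoc\<close>)
  have scale: "h (c *\<^sub>R p) = c * h p" if c: "0 < c" for c p
  proof (rule antisym[OF scale_le[OF c]])
    have "h ((1 / c) *\<^sub>R (c *\<^sub>R p)) \<le> 1 / c * h (c *\<^sub>R p)"
      by (rule scale_le) (use c in simp)
    then show "c * h p \<le> h (c *\<^sub>R p)" using c by (simp add: field_simps)
  qed
  have add: "h (p + q) \<le> h p + h q" for p q
    by (rule least) (use le[of p] le[of q] in \<open>simp add: inner_add_left distrib_right add_mono\<close>)
  have "convex_on UNIV h"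
  proof (rule convex_onI)
    fix t :: real and p q :: 'a
    assume "0 < t" "t < 1"
    then show "h ((1 - t) *\<^sub>R p + t *\<^sub>R q) \<le> (1 - t) * h p + t * h q"
      using add[of "(1 - t) *\<^sub>R p" "t *\<^sub>R q"] by (simp add: scale)
  qed simp
  moreover have "h 0 = 0"
    using scale[of 2 0] by simp
  moreover have "h p \<noteq> 0" if "p \<noteq> 0" for p
    using le[of p p] pos[OF that] that by (metis inner_gt_zero_iff mult_zero_left not_le)
  ultimately show ?thesis
    using scale unfolding is_norm_def by blast
qed

theorem corollary1p6:
  fixes M :: "'w measure"
    and V :: "int ^ 'd::finite \<Rightarrow> 'w \<Rightarrow> 'w"
    and \<tau> :: "('d, 'w) weights"
    and nr :: "real ^ 'd \<Rightarrow> 'w \<Rightarrow> int ^ 'd"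
    and m H :: "real ^ 'd \<Rightarrow> real"
  assumes "stationary_ergodic_fpp M V \<tau>"
    and "nearest_lattice_point M nr"
    and "is_time_constant M \<tau> nr m"
    and "is_limiting_hamiltonian M \<tau> H"
  shows "is_norm m \<and> is_norm H \<and>
    (\<forall>p. ereal (H p) = (SUP x\<in>{x. m x = 1}. ereal (p \<bullet> x)))"
proof -
  obtain a b where ab: "0 < a" "0 < b" "AE \<omega> in M. weights_between \<tau> a b \<omega>"
    using stationary_ergodic_fpp.AE_weights_between[OF assms(1)] .
  interpret fpp_time_constant M V \<tau> nr m a b
    using assms ab by (simp add: fpp_time_constant_def fpp_time_constant_axioms_def)
  have H: "AE \<omega> in M. ((\<lambda>t. - (control_value \<tau> p 0 t \<omega> / t)) \<longlongrightarrow> H p) at_top" for p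
    using assms(4) by (simp add: is_limiting_hamiltonian_def)
  note le = inner_le_hamiltonian[OF H] and least = hamiltonian_le[OF H]
  have m_nonneg: "0 \<le> m x" for x
    using time_constant_pos[of x] time_constant_0 by (cases "x = 0") auto
  have "ereal (H p) = (SUP x\<in>{x. m x = 1}. ereal (p \<bullet> x))" for p
  proof (rule antisym)
    show "(SUP x\<in>{x. m x = 1}. ereal (p \<bullet> x)) \<le> ereal (H p)"
      by (rule SUP_least) (use le[of p] in \<open>metis ereal_less_eq(3) mem_Collect_eq mult.right_neutral\<close>)
    show "ereal (H p) \<le> (SUP x\<in>{x. m x = 1}. ereal (p \<bullet> x))"
    proof (rule ccontr)
      assume "\<not> ?thesis"
      then obtain S where S: "(SUP x\<in>{x. m x = 1}. ereal (p \<bullet> x)) \<le> ereal S" "S < H p"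
        using ereal_dense2[of "SUP x\<in>{x. m x = 1}. ereal (p \<bullet> x)" "ereal (H p)"] 
        by (auto simp: not_le dest: less_imp_le)
      have "p \<bullet> x \<le> S" if "m x = 1" for x
        using S(1) that by (simp add: SUP_le_iff)
      from inner_le_if_unit_sphere[OF is_norm_time_constant m_nonneg this]
      show False using least[of p S] S(2) by simp
    qed
  qed
  then show ?thesis
    using is_norm_time_constant is_norm_dual[OF le least time_constant_pos] by blast
qed

end
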